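(* (Pieri rule.) For every integer $p>0$ and every partition $\lambda$, the following identity holds in $\mathbb{A}$: $$u_p\cdot U_\lambda=\sum_{\lambda\xrightarrow{p}\mu}U_\mu,$$ where the sum is over all partitions $\mu\supset\lambda$ such that $\lambda\xrightarrow{p}\mu$, i.e. such that $\mu/\lambda$ is a horizontal strip with $p$ boxes.
   Context: An integer sequence (integer vector) is a sequence $\alpha=(\alpha_1,\alpha_2,\ldots)$ of integers with only finitely many nonzero terms; its length $\ell(\alpha)$ is the largest $\ell\ge 0$ with $\alpha_\ell\ne 0$ (zero if $\alpha=0$), and finite vectors are identified with sequences by appending zeros. It is a partition if $\alpha_i\ge\alpha_{i+1}\ge 0$ for all $i$. Let $\mathbb{A}=\mathbb{Z}[u_1,u_2,\ldots]$ be the polynomial ring in countably many independent variables, with $u_0=1$ and $u_r=0$ for $r<0$. For an integer vector $\alpha$ put $u_\alpha=\prod_i u_{\alpha_i}$. For $i<j$ let $R_{ij}(\alpha)=(\alpha_1,\ldots,\alpha_i+1,\ldots,\alpha_j-1,\ldots)$; a raising operator $R$ is a monomial in the $R_{ij}$, and $R\,u_\alpha:=u_{R\alpha}$ (the operator acts on the index $\alpha$). The Schur polynomial of an integer vector $\alpha$ is $$U_\alpha:=\prod_{i<j}(1-R_{ij})\,u_\alpha\in\mathbb{A};$$ after formal expansion only finitely many summands are nonzero. Partitions are identified with Young diagrams; $\lambda\subset\mu$ means $\lambda_i\le\mu_i$ for all $i$, and then $\mu/\lambda$ is the skew diagram $\mu\smallsetminus\lambda$. A skew diagram is a horizontal strip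 if it does not contain two boxes in the same column. Write $\lambda\xrightarrow{p}\mu$ if $\mu/\lambda$ is a horizontal strip with $p$ boxes. *)

theory Defs
  imports "HOL-Library.Poly_Mapping"
begin

section \<open>Integer vectors and partitions\<close>

text \<open>Sequences are indexed from \<open>0\<close>: the entry \<open>\<alpha>\<^sub>i\<close> of the usual
  numbering is \<open>lookup \<alpha> (i - 1)\<close>.\<close>

type_synonym int_vec = "nat \<Rightarrow>\<^sub>0 int"

definition is_partition :: "int_vec \<Rightarrow> bool" where
  "is_partition \<alpha> \<longleftrightarrow> (\<forall>i. Poly_Mapping.lookup \<alpha> i \<ge> Poly_Mapping.lookup \<alpha> (Suc i) \<and>
     Poly_Mapping.lookup \<alpha> (Suc i) \<ge> 0)"


section \<open>The polynomial ring and the Schur polynomials\<close>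

text \<open>The ring \<open>\<int>[u\<^sub>1, u\<^sub>2, \<dots>]\<close>: finitely supported integer combinations of monomials,
  a monomial being the finitely supported map of its exponents.  The variable \<open>u\<^sub>r\<close>
  (\<open>r \<ge> 1\<close>) is the one numbered \<open>r - 1\<close>.\<close>

type_synonym poly_u = "(nat \<Rightarrow>\<^sub>0 nat) \<Rightarrow>\<^sub>0 int"

definition u :: "int \<Rightarrow> poly_u" where
  "u r = (if r < 0 then 0 else if r = 0 then 1
          else Poly_Mapping.single (Poly_Mapping.single (nat r - 1) 1) 1)"

text \<open>Entries outside \<open>keys \<alpha>\<close> are zero and would contribute \<open>u 0 = 1\<close>.\<close>

definition u_vec :: "int_vec \<Rightarrow> poly_u" where
  "u_vec \<alpha> = (\<Prod>i\<in>Poly_Mapping.keys \<alpha>. u (Poly_Mapping.lookup \<alpha> i))"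

definition raise :: "nat \<Rightarrow> nat \<Rightarrow> int_vec \<Rightarrow> int_vec" where
  "raise i j \<alpha> = \<alpha> + Poly_Mapping.single i 1 - Poly_Mapping.single j 1"

definition index_pairs :: "(nat \<times> nat) set" where
  "index_pairs = {(i, j). i < j}"

text \<open>A finite set \<open>S\<close> of index pairs stands for the square-free raising operator
  \<open>\<Prod>(i,j)\<in>S. R\<^sub>i\<^sub>j\<close>; the \<open>R\<^sub>i\<^sub>j\<close> commute, so this is a translation of the index.\<close>

definition raise_set :: "(nat \<times> nat) set \<Rightarrow> int_vec \<Rightarrow> int_vec" where
  "raise_set S \<alpha> =
     \<alpha> + (\<Sum>(i, j)\<in>S. Poly_Mapping.single i 1 - Poly_Mapping.single j 1)"

lemma raise_set_empty: "raise_set {} \<alpha> = \<alpha>"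
  by (simp add: raise_set_def)

lemma raise_set_insert:
  "finite S \<Longrightarrow> (i, j) \<notin> S \<Longrightarrow> raise_set (insert (i, j) S) \<alpha> = raise i j (raise_set S \<alpha>)"
  by (simp add: raise_set_def raise_def algebra_simps)

text \<open>The formal expansion of \<open>\<Prod>i<j. (1 - R\<^sub>i\<^sub>j)\<close> has one summand \<open>(-1)\<^sup>|\<^sup>S\<^sup>| \<Prod>(i,j)\<in>S. R\<^sub>i\<^sub>j\<close>
  for each finite set \<open>S\<close> of index pairs.  Only the sets whose summand does not vanish on
  \<open>u\<^sub>\<alpha>\<close> are kept; there are finitely many of them (\<open>finite_schur_support\<close>).\<close>

definition schur_support :: "int_vec \<Rightarrow> (nat \<times> nat) set set" where
  "schur_support \<alpha> = {S. finite S \<and> S \<subseteq> index_pairs \<and> u_vec (raise_set S \<alpha>) \<noteq> 0}"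

definition schur :: "int_vec \<Rightarrow> poly_u" where
  "schur \<alpha> = (\<Sum>S\<in>schur_support \<alpha>. (-1) ^ card S * u_vec (raise_set S \<alpha>))"

lemma u_vec_eq_0:
  assumes "Poly_Mapping.lookup \<alpha> i < 0"
  shows "u_vec \<alpha> = 0"
proof -
  have "i \<in> Poly_Mapping.keys \<alpha>" using assms by (simp add: in_keys_iff)
  moreover have "u (Poly_Mapping.lookup \<alpha> i) = 0" using assms by (simp add: u_def)
  ultimately show ?thesis unfolding u_vec_def
    by (metis Poly_Mapping.finite_keys prod_zero)
qed

lemma finite_schur_support: "finite (schur_support \<alpha>)"
proof -
  obtain n where n: "\<And>i. i \<ge> n \<Longrightarrow> Poly_Mapping.lookup \<alpha> i = 0"
  proof -
    have "\<exists>n. \<forall>i\<in>Poly_Mapping.keys \<alpha>. i < n"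
      using finite_keys finite_nat_set_iff_bounded by blast
    then show ?thesis using that by (meson in_keys_iff leD)
  qed
  have "schur_support \<alpha> \<subseteq> Pow ({..<n} \<times> {..<n})"
  proof
    fix S assume S: "S \<in> schur_support \<alpha>"
    then have fin: "finite S" and sub: "S \<subseteq> index_pairs"
      and nz: "u_vec (raise_set S \<alpha>) \<noteq> 0"
      by (auto simp: schur_support_def)
    have bound: "b < n" if "(a, b) \<in> S" for a b
    proof (rule ccontr)
      assume "\<not> b < n"
      define m where "m = Max (snd ` S)"
      have m_in: "m \<in> snd ` S" unfolding m_def using fin that by (intro Max_in) auto
      have m_ge: "q \<le> m" if "(p, q) \<in> S" for p q
        unfolding m_def using fin that by (intro Max_ge) force+
      have "n \<le> m" using m_ge[OF that] \<open>\<not> b < n\<close> by simp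
      obtain a' where a': "(a', m) \<in> S" using m_in by auto
      let ?f = "\<lambda>x. Poly_Mapping.lookup (case x of (i, j) \<Rightarrow>
                 Poly_Mapping.single i 1 - Poly_Mapping.single j (1::int)) m"
      have le: "?f x \<le> 0" if "x \<in> S" for x
      proof (cases x)
        case (Pair p q)
        then have "p < q" "q \<le> m" using that sub m_ge by (auto simp: index_pairs_def)
        then show ?thesis using Pair by (simp add: lookup_minus lookup_single when_def)
      qed
      have "a' < m" using a' sub by (auto simp: index_pairs_def)
      then have lt: "?f (a', m) < 0" by (simp add: lookup_minus lookup_single when_def)
      have "(\<Sum>x\<in>S. ?f x) < (\<Sum>x\<in>S. 0)"
      proof (rule sum_strict_mono_ex1[OF fin])
        show "\<forall>x\<in>S. ?f x \<le> 0" using le by blast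
        show "\<exists>x\<in>S. ?f x < 0" using lt a' by (rule bexI)
      qed
      then have "Poly_Mapping.lookup (raise_set S \<alpha>) m < 0"
        using n[OF \<open>n \<le> m\<close>] by (simp add: raise_set_def lookup_add lookup_sum)
      then show False using u_vec_eq_0 nz by blast
    qed
    show "S \<in> Pow ({..<n} \<times> {..<n})"
    proof (intro PowI subsetI)
      fix x assume x: "x \<in> S"
      obtain a b where "x = (a, b)" by (cases x)
      then show "x \<in> {..<n} \<times> {..<n}"
        using x bound[of a b] sub by (auto simp: index_pairs_def)
    qed
  qed
  then show ?thesis by (rule finite_subset) simp
qed


section \<open>Horizontal strips\<close>

text \<open>A box \<open>(i, j)\<close> lies in row \<open>i\<close> and column \<open>j\<close>, both counted from \<open>0\<close>.\<close>

definition diagram :: "int_vec \<Rightarrow> (nat \<times> nat) set" where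
  "diagram lam = {(i, j). int j < Poly_Mapping.lookup lam i}"

definition contained :: "int_vec \<Rightarrow> int_vec \<Rightarrow> bool" where
  "contained lam \<mu> \<longleftrightarrow> (\<forall>i. Poly_Mapping.lookup lam i \<le> Poly_Mapping.lookup \<mu> i)"

definition horizontal_strip :: "(nat \<times> nat) set \<Rightarrow> bool" where
  "horizontal_strip D \<longleftrightarrow>
     \<not> (\<exists>i i' j. i \<noteq> i' \<and> (i, j) \<in> D \<and> (i', j) \<in> D)"

definition pieri_step :: "int_vec \<Rightarrow> int \<Rightarrow> int_vec \<Rightarrow> bool" where
  "pieri_step lam p \<mu> \<longleftrightarrow> contained lam \<mu> \<and>
     horizontal_strip (diagram \<mu> - diagram lam) \<and> int (card (diagram \<mu> - diagram lam)) = p"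

text \<open>The sum in the Pieri rule is finite.\<close>

lemma finite_pieri:
  assumes part: "is_partition lam" and p: "p > 0"
  shows "finite {\<mu>. is_partition \<mu> \<and> pieri_step lam p \<mu>}"
proof -
  have "finite (Poly_Mapping.keys lam)" by simp
  then obtain n where n0: "\<forall>i\<in>Poly_Mapping.keys lam. i < n"
    using finite_nat_set_iff_bounded by blast
  have n: "Poly_Mapping.lookup lam i = 0" if "i \<ge> n" for i
    using n0 that by (meson in_keys_iff leD)
  have nonneg: "Poly_Mapping.lookup \<mu> i \<ge> 0" if "is_partition \<mu>" for \<mu> i
    using that unfolding is_partition_def by (meson order_trans)
  have anti: "Poly_Mapping.lookup \<mu> j \<le> Poly_Mapping.lookup \<mu> i"
    if "is_partition \<mu>" "i \<le> j" for \<mu> i j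
    using that(2) by (rule lift_Suc_antimono_le[rotated])
      (use that(1) in \<open>simp add: is_partition_def\<close>)
  let ?P = "{\<mu>. is_partition \<mu> \<and> pieri_step lam p \<mu>}"
  let ?f = "\<lambda>\<mu>. map (Poly_Mapping.lookup \<mu>) [0..<Suc n]"
  let ?B = "{0..Poly_Mapping.lookup lam 0 + p}"
  have zero: "Poly_Mapping.lookup \<mu> i = 0" if "\<mu> \<in> ?P" "i > n" for \<mu> i
  proof (rule ccontr)
    assume "Poly_Mapping.lookup \<mu> i \<noteq> 0"
    then have "Poly_Mapping.lookup \<mu> i > 0" using nonneg[of \<mu> i] that by simp
    moreover have "Poly_Mapping.lookup \<mu> i \<le> Poly_Mapping.lookup \<mu> n"
      using anti that by simp
    ultimately have "(i, 0) \<in> diagram \<mu> - diagram lam" "(n, 0) \<in> diagram \<mu> - diagram lam"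
      using n[of i] n[of n] that(2) by (auto simp: diagram_def)
    moreover have "horizontal_strip (diagram \<mu> - diagram lam)"
      using that(1) by (simp add: pieri_step_def)
    ultimately have "i = n" unfolding horizontal_strip_def by metis
    then show False using that(2) by simp
  qed
  have le: "Poly_Mapping.lookup \<mu> i \<le> Poly_Mapping.lookup lam 0 + p" if "\<mu> \<in> ?P" for \<mu> i
  proof -
    let ?D = "diagram \<mu> - diagram lam"
    have card: "int (card ?D) = p" using that by (simp add: pieri_step_def)
    then have "finite ?D" using p by (metis card.infinite of_nat_0 less_irrefl)
    moreover have
      "Pair i ` {nat (Poly_Mapping.lookup lam i)..<nat (Poly_Mapping.lookup \<mu> i)} \<subseteq> ?D"
      by (auto simp: diagram_def)
    ultimately have
      "card (Pair i ` {nat (Poly_Mapping.lookup lam i)..<nat (Poly_Mapping.lookup \<mu> i)})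
        \<le> card ?D" by (intro card_mono)
    then have
      "nat (Poly_Mapping.lookup \<mu> i) - nat (Poly_Mapping.lookup lam i) \<le> card ?D"
      by (simp add: card_image inj_on_def)
    then show ?thesis
      using card nonneg[OF part, of i] anti[OF part, of 0 i] by linarith
  qed
  have "inj_on ?f ?P"
  proof (rule inj_onI)
    fix \<mu> \<nu> assume h: "\<mu> \<in> ?P" "\<nu> \<in> ?P" "?f \<mu> = ?f \<nu>"
    have "Poly_Mapping.lookup \<mu> i = Poly_Mapping.lookup \<nu> i" for i
    proof (cases "i \<le> n")
      case True
      then have "i \<in> set [0..<Suc n]" by auto
      then show ?thesis using h(3) unfolding map_eq_conv by blast
    next
      case False
      then show ?thesis using zero h by simp
    qed
    then show "\<mu> = \<nu>" by (intro poly_mapping_eqI)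
  qed
  moreover have "?f ` ?P \<subseteq> {xs. set xs \<subseteq> ?B \<and> length xs = Suc n}"
    using nonneg le by (auto simp del: upt_Suc)
  moreover have "finite {xs. set xs \<subseteq> ?B \<and> length xs = Suc n}"
    by (rule finite_lists_length_eq) simp
  ultimately show ?thesis by (meson finite_imageD finite_subset)
qed

end

theory Submission
  imports Defs "HOL-Library.FuncSet" "HOL-Combinatorics.Transposition"
begin

text \<open>
  Two facts about Schur polynomials of arbitrary integer vectors give the Pieri rule.

  \<^emph>\<open>Antisymmetry.\<close>  \<open>u_vec\<close> is a symmetric function of the entries of its index, and exchanging
  the indices \<open>k\<close> and \<open>k + 1\<close> turns the product \<open>\<Prod>i<j. (1 - R\<^sub>i\<^sub>j)\<close> into itself times
  \<open>- R\<close>, where \<open>R\<close> is the inverse of \<open>R\<^bsub>k,k+1\<^esub>\<close>.  Hence replacing two adjacent entries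
  \<open>a, b\<close> by \<open>b - 1, a + 1\<close> changes the sign of the Schur polynomial (\<open>schur_reflect\<close>).

  \<^emph>\<open>Adding a row.\<close>  Let the nonzero entries of \<open>lam\<close> lie in rows \<open>i < m\<close>.  The polynomial with index
  \<open>lam\<close> followed by \<open>p\<close> in row \<open>m\<close> is obtained from \<open>u p * schur lam\<close> by the operator
  \<open>\<Prod>i<m. (1 - R\<^sub>i\<^sub>m)\<close> acting on the index (\<open>schur_expand_last\<close>).  Inverting each factor by a geometric
  series writes \<open>u p * schur lam\<close> as the sum of \<open>schur \<mu>\<close> over all integer vectors \<open>\<mu>\<close> that
  arise from \<open>lam\<close> by adding \<open>p\<close> boxes in the rows \<open>0, \<dots>, m\<close> in any way (\<open>sum_enlargements\<close>).

  Among these vectors, the partitions for which \<open>\<mu>/lam\<close> is a horizontal strip are exactly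
  those with \<open>\<mu>\<^sub>i\<^sub>+\<^sub>1 \<le> lam\<^sub>i\<close> for all \<open>i\<close> (\<open>pieri_step_iff\<close>).  All others cancel
  (\<open>sum_not_interlacing\<close>): if \<open>k\<close> is the largest row with \<open>lam\<^sub>k < \<mu>\<^sub>k\<^sub>+\<^sub>1\<close>, then exchanging
  \<open>\<mu>\<^sub>k, \<mu>\<^sub>k\<^sub>+\<^sub>1\<close> for \<open>\<mu>\<^sub>k\<^sub>+\<^sub>1 - 1, \<mu>\<^sub>k + 1\<close> yields another such vector with the same \<open>k\<close>
  and the opposite Schur polynomial, or \<open>\<mu>\<close> itself, in which case \<open>schur \<mu> = 0\<close>.
\<close>

section \<open>Permuting and translating indices\<close>

abbreviation lookup :: "int_vec \<Rightarrow> nat \<Rightarrow> int"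
  where "lookup \<equiv> Poly_Mapping.lookup"

lemma u_vec_eq_prod:
  assumes "finite I" "Poly_Mapping.keys \<alpha> \<subseteq> I"
  shows "u_vec \<alpha> = (\<Prod>i\<in>I. u (lookup \<alpha> i))"
  unfolding u_vec_def
  by (rule prod.mono_neutral_left) (use assms in \<open>auto simp: in_keys_iff u_def\<close>)

lemma lookup_map_key: "inj f \<Longrightarrow> lookup (Poly_Mapping.map_key f \<alpha>) i = lookup \<alpha> (f i)"
  by (simp add: Poly_Mapping.map_key.rep_eq)

lemma u_vec_map_key:
  assumes "bij f"
  shows "u_vec (Poly_Mapping.map_key f \<alpha>) = u_vec \<alpha>"
proof -
  have inj: "inj f" using assms by (rule bij_is_inj)
  have "bij_betw f (f -` Poly_Mapping.keys \<alpha>) (Poly_Mapping.keys \<alpha>)"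
    using assms by (auto simp: bij_betw_def inj_on_def bij_def)
  then show ?thesis
    unfolding u_vec_def keys_map_key[OF inj]
    by (subst prod.reindex_bij_betw[symmetric])
       (simp_all add: lookup_map_key[OF inj])
qed

definition shift :: "(nat \<times> nat) set \<Rightarrow> int_vec" where
  "shift S = (\<Sum>(i, j)\<in>S. Poly_Mapping.single i 1 - Poly_Mapping.single j 1)"

lemma raise_set_shift: "raise_set S \<alpha> = \<alpha> + shift S"
  by (simp add: raise_set_def shift_def)

lemma lookup_shift:
  "lookup (shift S) x = (\<Sum>(i, j)\<in>S. of_bool (i = x) - of_bool (j = x))"
  unfolding shift_def lookup_sum
  by (rule sum.cong) (auto simp: lookup_minus lookup_single when_def)

lemma shift_Un:
  "finite S \<Longrightarrow> finite T \<Longrightarrow> S \<inter> T = {} \<Longrightarrow> shift (S \<union> T) = shift S + shift T"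
  unfolding shift_def by (rule sum.union_disjoint)

lemma shift_insert:
  "finite S \<Longrightarrow> (i, j) \<notin> S \<Longrightarrow>
     shift (insert (i, j) S) = Poly_Mapping.single i 1 - Poly_Mapping.single j 1 + shift S"
  by (simp add: shift_def)

lemma shift_map_prod:
  assumes "\<And>x. f (f x) = x"
  shows "shift (map_prod f f ` S) = Poly_Mapping.map_key f (shift S)"
proof -
  have inj: "inj f" using assms by (metis injI)
  have eq: "f a = x \<longleftrightarrow> a = f x" for a x using assms by metis
  show ?thesis
  proof (rule poly_mapping_eqI)
    fix x
    have "inj_on (map_prod f f) S"
      using inj by (auto simp: inj_on_def)
    then show "lookup (shift (map_prod f f ` S)) x =
        lookup (Poly_Mapping.map_key f (shift S)) x"
      unfolding lookup_shift lookup_map_key[OF inj]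
      by (simp add: sum.reindex case_prod_unfold eq)
  qed
qed

section \<open>Antisymmetry under adjacent reflections\<close>

text \<open>This is the action of an adjacent transposition on \<open>\<alpha> + \<rho>\<close>, where
  \<open>\<rho> = (0, -1, -2, \<dots>)\<close>.\<close>

definition reflect :: "nat \<Rightarrow> int_vec \<Rightarrow> int_vec" where
  "reflect k \<alpha> = Poly_Mapping.map_key (transpose k (Suc k)) \<alpha>
     + Poly_Mapping.single (Suc k) 1 - Poly_Mapping.single k 1"

lemma lookup_reflect:
  "lookup (reflect k \<alpha>) i =
     (if i = k then lookup \<alpha> (Suc k) - 1
      else if i = Suc k then lookup \<alpha> k + 1 else lookup \<alpha> i)"
  by (auto simp: reflect_def lookup_add lookup_minus lookup_single when_def
      lookup_map_key)

lemma reflect_reflect: "reflect k (reflect k \<alpha>) = \<alpha>"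
  by (rule poly_mapping_eqI) (simp add: lookup_reflect)

text \<open>The effect of the transposition of \<open>k\<close> and \<open>k + 1\<close> on the expansion of
  \<open>\<Prod>i<j. (1 - R\<^sub>i\<^sub>j)\<close>.  It permutes the factors other than \<open>(k, k + 1)\<close>; that one goes to
  \<open>1 - R\<^bsub>k+1,k\<^esub>\<close>, which up to sign and translation is the same factor with its two
  summands exchanged.\<close>

definition toggle :: "nat \<Rightarrow> (nat \<times> nat) set \<Rightarrow> (nat \<times> nat) set" where
  "toggle k S = map_prod (transpose k (Suc k)) (transpose k (Suc k)) ` (S - {(k, Suc k)})
     \<union> ({(k, Suc k)} - S)"

lemma transpose_image_index_pairs:
  assumes "S \<subseteq> index_pairs"
  shows "map_prod (transpose k (Suc k)) (transpose k (Suc k)) ` (S - {(k, Suc k)})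
    \<subseteq> index_pairs - {(k, Suc k)}"
proof
  fix x
  assume "x \<in> map_prod (transpose k (Suc k)) (transpose k (Suc k)) ` (S - {(k, Suc k)})"
  then obtain i j where "(i, j) \<in> S" "(i, j) \<noteq> (k, Suc k)"
    and x: "x = (transpose k (Suc k) i, transpose k (Suc k) j)" by auto
  with assms have "i < j" "i = k \<longrightarrow> j \<noteq> Suc k" by (auto simp: index_pairs_def)
  then show "x \<in> index_pairs - {(k, Suc k)}"
    unfolding x by (auto simp: index_pairs_def transpose_def)
qed

lemma toggle_toggle:
  assumes "S \<subseteq> index_pairs"
  shows "toggle k (toggle k S) = S"
proof -
  let ?e = "(k, Suc k)"
  let ?m = "map_prod (transpose k (Suc k)) (transpose k (Suc k))"
  have "?m ` (S - {?e}) \<subseteq> index_pairs - {?e}"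
    using assms by (rule transpose_image_index_pairs)
  then have "toggle k S - {?e} = ?m ` (S - {?e})" "?e \<in> toggle k S \<longleftrightarrow> ?e \<notin> S"
    by (auto simp: toggle_def)
  moreover have "?m ` ?m ` (S - {?e}) = S - {?e}"
    by (simp add: image_image map_prod_def case_prod_unfold)
  ultimately show ?thesis
    unfolding toggle_def[of k "toggle k S"] by auto
qed

lemma
  assumes "finite S" "S \<subseteq> index_pairs"
  shows finite_toggle: "finite (toggle k S)"
    and toggle_subset: "toggle k S \<subseteq> index_pairs"
    and sign_toggle: "(-1) ^ card (toggle k S) = - ((-1) ^ card S :: 'a :: ring_1)"
    and raise_set_toggle: "raise_set (toggle k S) (reflect k \<alpha>)
      = Poly_Mapping.map_key (transpose k (Suc k)) (raise_set S \<alpha>)"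
proof -
  let ?e = "(k, Suc k)" and ?s = "transpose k (Suc k)"
  let ?T = "map_prod ?s ?s ` (S - {?e})"
  have T: "?T \<subseteq> index_pairs - {?e}"
    using assms(2) by (rule transpose_image_index_pairs)
  have finT: "finite ?T" using assms(1) by simp
  show "finite (toggle k S)" using assms(1) by (simp add: toggle_def)
  show "toggle k S \<subseteq> index_pairs" using T by (auto simp: toggle_def index_pairs_def)
  have "inj (map_prod ?s ?s)"
    by (intro prod.inj_map inj_transpose)
  then have cardT: "card ?T = card (S - {?e})"
    by (meson card_image inj_on_subset subset_UNIV)
  have shiftT: "shift ?T = Poly_Mapping.map_key ?s (shift (S - {?e}))"
    by (rule shift_map_prod) simp
  have S: "toggle k S = insert ?e ?T" if "?e \<notin> S"
    using that by (auto simp: toggle_def)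
  have S': "toggle k S = ?T" if "?e \<in> S"
    using that by (auto simp: toggle_def)
  have ins: "S = insert ?e (S - {?e})" if "?e \<in> S" using that by auto
  show "(-1) ^ card (toggle k S) = - ((-1) ^ card S :: 'a :: ring_1)"
  proof (cases "?e \<in> S")
    case True
    then have "card S = Suc (card (S - {?e}))" by (rule card.remove[OF assms(1)])
    then show ?thesis unfolding S'[OF True] cardT by simp
  next
    case False
    then have "card (toggle k S) = Suc (card S)"
      unfolding S[OF False] using T finT cardT False by (subst card_insert_disjoint) auto
    then show ?thesis by simp
  qed
  have mk: "Poly_Mapping.map_key ?s (p + q)
      = Poly_Mapping.map_key ?s p + Poly_Mapping.map_key ?s q"
    for p q :: int_vec by (rule map_key_plus) simp
  show "raise_set (toggle k S) (reflect k \<alpha>) = Poly_Mapping.map_key ?s (raise_set S \<alpha>)"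
  proof (cases "?e \<in> S")
    case True
    have "shift S = Poly_Mapping.single k 1 - Poly_Mapping.single (Suc k) 1 + shift (S - {?e})"
      using ins[OF True] shift_insert[of "S - {?e}" k "Suc k"] assms(1) by simp
    then show ?thesis
      unfolding S'[OF True] raise_set_shift mk shiftT
      by (intro poly_mapping_eqI)
         (auto simp: lookup_add lookup_minus lookup_reflect lookup_map_key lookup_single when_def
           transpose_def)
  next
    case False
    have "shift (toggle k S)
        = Poly_Mapping.single k 1 - Poly_Mapping.single (Suc k) 1 + shift ?T"
      unfolding S[OF False] by (rule shift_insert) (use T finT in auto)
    then show ?thesis
      using False unfolding raise_set_shift mk shiftT
      by (intro poly_mapping_eqI)
         (auto simp: lookup_add lookup_minus lookup_reflect lookup_map_key lookup_single when_def
           transpose_def)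
  qed
qed

text \<open>\<open>toggle k\<close> matches the summands of the two expansions: the indices of corresponding
  summands differ by a transposition of entries, which \<open>u_vec\<close> does not see, and their
  signs are opposite.\<close>

lemma schur_reflect: "schur (reflect k \<alpha>) = - schur \<alpha>"
proof -
  have supp: "toggle k S \<in> schur_support (reflect k \<alpha>)" if "S \<in> schur_support \<alpha>" for S \<alpha>
    using that finite_toggle[of S k] toggle_subset[of S k] raise_set_toggle[of S k \<alpha>]
    by (auto simp: schur_support_def u_vec_map_key)
  have "- schur \<alpha> = (\<Sum>S\<in>schur_support \<alpha>. - ((-1) ^ card S) * u_vec (raise_set S \<alpha>))"
    by (simp add: schur_def sum_negf)
  also have "\<dots> = schur (reflect k \<alpha>)"
    unfolding schur_def
  proof (rule sum.reindex_bij_witness[where i = "toggle k" and j = "toggle k"], goal_cases)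
    case (4 S)
    then show ?case using supp[of S "reflect k \<alpha>"] by (simp add: reflect_reflect)
  next
    case (5 S)
    then show ?case
      using sign_toggle[where 'a = poly_u and S = S and k = k]
        raise_set_toggle[of S k \<alpha>] by (simp add: schur_support_def u_vec_map_key)
  qed (simp_all add: supp, simp_all add: schur_support_def toggle_toggle)
  finally show ?thesis by simp
qed


section \<open>Expansion along the last row\<close>

definition pairs :: "nat \<Rightarrow> (nat \<times> nat) set" where
  "pairs n = {(i, j). i < j \<and> j < n}"

lemma finite_pairs: "finite (pairs n)"
  by (rule finite_subset[of _ "{..<n} \<times> {..<n}"]) (auto simp: pairs_def)

text \<open>An operator that lowers an entry beyond the support of \<open>\<alpha>\<close> makes the entry at the
  largest lowered position negative, since nothing raises it, so its summand vanishes.\<close>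

lemma schur_support_subset:
  assumes "Poly_Mapping.keys \<alpha> \<subseteq> {..<n}"
  shows "schur_support \<alpha> \<subseteq> Pow (pairs n)"
proof
  fix S
  assume S: "S \<in> schur_support \<alpha>"
  then have fin: "finite S" and sub: "S \<subseteq> index_pairs" and nz: "u_vec (raise_set S \<alpha>) \<noteq> 0"
    by (auto simp: schur_support_def)
  show "S \<in> Pow (pairs n)"
  proof (rule ccontr)
    assume "S \<notin> Pow (pairs n)"
    then obtain a b where "(a, b) \<in> S" "(a, b) \<notin> pairs n" by auto
    with sub have ab: "(a, b) \<in> S" "n \<le> b"
      by (auto simp: pairs_def index_pairs_def)
    define m where "m = Max (snd ` S)"
    have "m \<in> snd ` S" unfolding m_def using fin ab by (intro Max_in) auto
    then obtain a' where a': "(a', m) \<in> S" by auto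
    have m_ge: "j \<le> m" if "(i, j) \<in> S" for i j
      unfolding m_def using fin that by (intro Max_ge) force+
    have "lookup (shift S) m = of_bool (a' = m) - of_bool (m = m)
        + (\<Sum>(i, j)\<in>S - {(a', m)}. of_bool (i = m) - of_bool (j = m))"
      unfolding lookup_shift by (subst sum.remove[OF fin a']) simp
    also have "(\<Sum>(i, j)\<in>S - {(a', m)}. of_bool (i = m) - of_bool (j = m)) \<le> (0::int)"
      by (rule sum_nonpos) (use sub m_ge in \<open>fastforce simp: index_pairs_def\<close>)
    finally have "lookup (shift S) m < 0"
      using a' sub by (auto simp: index_pairs_def)
    moreover have "lookup \<alpha> m = 0"
      using assms m_ge[OF ab(1)] ab(2) by (metis in_keys_iff lessThan_iff subsetD leD le_trans)
    ultimately show False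
      using u_vec_eq_0[of "raise_set S \<alpha>" m] nz by (simp add: raise_set_shift lookup_add)
  qed
qed

lemma schur_eq_sum:
  assumes "Poly_Mapping.keys \<alpha> \<subseteq> {..<n}"
  shows "schur \<alpha> = (\<Sum>S\<in>Pow (pairs n). (-1) ^ card S * u_vec (raise_set S \<alpha>))"
  unfolding schur_def
proof (rule sum.mono_neutral_left)
  show "\<forall>S\<in>Pow (pairs n) - schur_support \<alpha>. (-1) ^ card S * u_vec (raise_set S \<alpha>) = 0"
    using finite_subset[OF _ finite_pairs]
    by (auto simp: schur_support_def pairs_def index_pairs_def)
qed (simp_all add: finite_pairs schur_support_subset[OF assms])

lemma lookup_shift_pairs:
  assumes "S \<subseteq> pairs m" "m \<le> i"
  shows "lookup (shift S) i = 0"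
  unfolding lookup_shift
  by (rule sum.neutral) (use assms in \<open>auto simp: pairs_def\<close>)

lemma lookup_shift_column:
  assumes "A \<subseteq> {..<m}"
  shows "lookup (shift (A \<times> {m})) i =
    (if i = m then - int (card A) else of_bool (i \<in> A))"
proof -
  have fin: "finite A" using assms finite_subset by blast
  have "m \<notin> A" using assms by auto
  have "lookup (shift (A \<times> {m})) i = (\<Sum>a\<in>A. of_bool (a = i) - of_bool (m = i))"
    unfolding lookup_shift
    by (rule sum.reindex_bij_witness[of _ "\<lambda>a. (a, m)" fst]) auto
  also have "\<dots> = of_bool (i \<in> A) - of_bool (m = i) * int (card A)"
    using fin by (simp add: sum_subtractf of_bool_def)
  finally show ?thesis using \<open>m \<notin> A\<close> by auto
qed

text \<open>The value at \<open>\<nu>\<close> of the raising operators among the rows \<open>i < m\<close> alone: they leave the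
  entry in row \<open>m\<close> untouched, so it splits off as a factor.\<close>

definition split_last :: "nat \<Rightarrow> int_vec \<Rightarrow> poly_u" where
  "split_last m \<nu> = u (lookup \<nu> m) * schur (\<nu> - Poly_Mapping.single m (lookup \<nu> m))"

lemma split_last_eq_sum:
  assumes "Poly_Mapping.keys \<nu> \<subseteq> {..m}"
  shows "split_last m \<nu> = (\<Sum>S\<in>Pow (pairs m). (-1) ^ card S * u_vec (raise_set S \<nu>))"
proof -
  let ?\<nu> = "\<nu> - Poly_Mapping.single m (lookup \<nu> m)"
  have zero: "lookup \<nu> i = 0" if "m < i" for i
    using assms that by (metis atMost_iff in_keys_iff leD subsetD)
  have keys: "Poly_Mapping.keys ?\<nu> \<subseteq> {..<m}"
  proof
    fix i
    assume "i \<in> Poly_Mapping.keys ?\<nu>"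
    then show "i \<in> {..<m}"
      using zero[of i] by (cases i m rule: linorder_cases)
        (auto simp: in_keys_iff lookup_minus lookup_single)
  qed
  have "u (lookup \<nu> m) * u_vec (raise_set S ?\<nu>) = u_vec (raise_set S \<nu>)"
    if S: "S \<subseteq> pairs m" for S
  proof -
    have 1: "Poly_Mapping.keys (raise_set S \<nu>) \<subseteq> {..<Suc m}"
      using zero lookup_shift_pairs[OF S]
      by (auto simp: in_keys_iff raise_set_shift lookup_add)
        (metis leI less_imp_le_nat add_0 Suc_le_eq not_less_eq)
    have 2: "Poly_Mapping.keys (raise_set S ?\<nu>) \<subseteq> {..<m}"
      using zero lookup_shift_pairs[OF S] keys
      by (auto simp: in_keys_iff raise_set_shift lookup_add)
        (metis leI add_0 in_keys_iff lessThan_iff subsetD)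
    have "u_vec (raise_set S \<nu>) = (\<Prod>i<Suc m. u (lookup (raise_set S \<nu>) i))"
      by (rule u_vec_eq_prod[OF _ 1]) simp
    also have "\<dots> = (\<Prod>i<m. u (lookup (raise_set S \<nu>) i)) * u (lookup \<nu> m)"
      by (simp add: raise_set_shift lookup_add lookup_shift_pairs[OF S])
    also have "(\<Prod>i<m. u (lookup (raise_set S \<nu>) i)) = (\<Prod>i<m. u (lookup (raise_set S ?\<nu>) i))"
      by (rule prod.cong) (auto simp: raise_set_shift lookup_add lookup_minus lookup_single)
    also have "\<dots> = u_vec (raise_set S ?\<nu>)"
      by (rule u_vec_eq_prod[OF _ 2, symmetric]) simp
    finally show ?thesis by (simp add: mult.commute)
  qed
  then show ?thesis
    unfolding split_last_def schur_eq_sum[OF keys] sum_distrib_left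
    by (intro sum.cong) (auto simp: mult.left_commute)
qed

text \<open>Expanding only the factors \<open>1 - R\<^sub>i\<^sub>m\<close>: the set \<open>A \<times> {m}\<close> stands for
  \<open>\<Prod>i\<in>A. R\<^sub>i\<^sub>m\<close>.\<close>

lemma schur_expand_last:
  assumes "Poly_Mapping.keys \<mu> \<subseteq> {..m}"
  shows "schur \<mu> =
    (\<Sum>A\<in>Pow {..<m}. (-1) ^ card A * split_last m (raise_set (A \<times> {m}) \<mu>))"
proof -
  have zero: "lookup \<mu> i = 0" if "m < i" for i
    using assms that by (metis atMost_iff in_keys_iff leD subsetD)
  have keys: "Poly_Mapping.keys (raise_set (A \<times> {m}) \<mu>) \<subseteq> {..m}" if "A \<subseteq> {..<m}" for A
  proof
    fix i
    assume "i \<in> Poly_Mapping.keys (raise_set (A \<times> {m}) \<mu>)"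
    then show "i \<in> {..m}"
      using that zero[of i]
      by (cases "m < i") (auto simp: in_keys_iff raise_set_shift lookup_add lookup_shift_column)
  qed
  have "(\<Sum>A\<in>Pow {..<m}. (-1) ^ card A * split_last m (raise_set (A \<times> {m}) \<mu>))
    = (\<Sum>A\<in>Pow {..<m}. \<Sum>S\<in>Pow (pairs m).
        (-1) ^ card A * ((-1) ^ card S * u_vec (raise_set S (raise_set (A \<times> {m}) \<mu>))))"
    by (simp add: split_last_eq_sum[OF keys] sum_distrib_left)
  also have "\<dots> = (\<Sum>(A, S)\<in>Pow {..<m} \<times> Pow (pairs m).
        (-1) ^ card A * ((-1) ^ card S * u_vec (raise_set S (raise_set (A \<times> {m}) \<mu>))))"
    by (simp add: sum.cartesian_product)
  also have "\<dots> = (\<Sum>T\<in>Pow (pairs (Suc m)). (-1) ^ card T * u_vec (raise_set T \<mu>))"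
  proof (rule sum.reindex_bij_witness[where j = "\<lambda>(A, S). A \<times> {m} \<union> S" and
        i = "\<lambda>T. ({a. (a, m) \<in> T}, T \<inter> pairs m)"], goal_cases)
    case (5 AS)
    then obtain A S where AS: "AS = (A, S)" "A \<subseteq> {..<m}" "S \<subseteq> pairs m" by auto
    have fin: "finite (A \<times> {m})" "finite S"
      using AS(2,3) finite_pairs finite_subset by blast+
    have disj: "A \<times> {m} \<inter> S = {}" using AS(3) by (auto simp: pairs_def)
    have sh: "shift (A \<times> {m} \<union> S) = shift (A \<times> {m}) + shift S"
      by (rule shift_Un[OF fin disj])
    have "card (A \<times> {m} \<union> S) = card A + card S"
      using card_Un_disjoint[OF fin disj] by (simp add: card_cartesian_product)
    then show ?case
      by (simp only: AS(1) split raise_set_shift sh power_add add.assoc mult.assoc)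
  qed (auto simp: pairs_def less_Suc_eq)
  also have "\<dots> = schur \<mu>"
    by (rule schur_eq_sum[symmetric]) (use assms in auto)
  finally show ?thesis by simp
qed


section \<open>Multiplication by one generator\<close>

definition enlargements :: "nat \<Rightarrow> int_vec \<Rightarrow> int \<Rightarrow> int_vec set" where
  "enlargements m lam p = {\<mu>. Poly_Mapping.keys \<mu> \<subseteq> {..m} \<and> contained lam \<mu> \<and>
     (\<Sum>i\<le>m. lookup \<mu> i - lookup lam i) = p}"

lemma keys_subset_atMost_iff:
  "Poly_Mapping.keys \<mu> \<subseteq> {..m} \<longleftrightarrow> (\<forall>i>m. lookup \<mu> i = 0)" for \<mu> :: int_vec
  by (auto simp: in_keys_iff subset_iff) (meson leI)+

lemma finite_enlargements: "finite (enlargements m lam p)"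
proof -
  let ?f = "\<lambda>\<mu>. restrict (lookup \<mu>) {..m}"
  have bound: "lookup \<mu> i \<le> lookup lam i + p" if "\<mu> \<in> enlargements m lam p" "i \<le> m" for \<mu> i
  proof -
    have "lookup \<mu> i - lookup lam i \<le> (\<Sum>i\<le>m. lookup \<mu> i - lookup lam i)"
      by (rule member_le_sum) (use that in \<open>auto simp: enlargements_def contained_def\<close>)
    then show ?thesis using that by (simp add: enlargements_def)
  qed
  have "?f ` enlargements m lam p \<subseteq> (\<Pi>\<^sub>E i\<in>{..m}. {lookup lam i..lookup lam i + p})"
    using bound by (auto simp: PiE_def enlargements_def contained_def)
  moreover have "finite (\<Pi>\<^sub>E i\<in>{..m}. {lookup lam i..lookup lam i + p})"
    by (rule finite_PiE) auto
  moreover have "inj_on ?f (enlargements m lam p)"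
  proof (intro inj_onI poly_mapping_eqI)
    fix \<mu> \<nu> i
    assume "\<mu> \<in> enlargements m lam p" "\<nu> \<in> enlargements m lam p" "?f \<mu> = ?f \<nu>"
    then show "lookup \<mu> i = lookup \<nu> i"
      by (cases "i \<le> m") (auto simp: enlargements_def keys_subset_atMost_iff dest: fun_cong[of _ _ i])
  qed
  ultimately show ?thesis by (meson finite_imageD finite_subset)
qed

lemma sum_alternating_Pow:
  "finite X \<Longrightarrow> (\<Sum>A\<in>Pow X. (-1) ^ card A) = (of_bool (X = {}) :: 'a :: comm_ring_1)"
  using prod_diff_conv_sum[of X "\<lambda>_. 1 :: 'a" "\<lambda>_. 1"]
  by (cases "X = {}") (simp_all add: power_0_left card_gt_0_iff)

lemma split_last_eq_0:
  "lookup \<nu> m < 0 \<Longrightarrow> split_last m \<nu> = 0"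
  by (simp add: split_last_def u_def)

text \<open>The inversion of \<open>\<Prod>i<m. (1 - R\<^sub>i\<^sub>m)\<close> by geometric series, in the form of an exchange of
  summations.  After expanding each \<open>schur \<mu>\<close> along row \<open>m\<close>, a vector \<open>\<nu>\<close> is reached once,
  with sign \<open>(-1) ^ card A\<close>, for each set \<open>A\<close> of rows \<open>i < m\<close> in which \<open>\<nu>\<close> exceeds
  \<open>lam\<close>.  These signs add up to zero unless there is no such row, that is, unless all \<open>p\<close>
  new boxes lie in row \<open>m\<close>.\<close>

lemma sum_enlargements:
  assumes lam: "Poly_Mapping.keys lam \<subseteq> {..<m}" and p: "0 \<le> p"
  shows "(\<Sum>\<mu>\<in>enlargements m lam p. schur \<mu>) = u p * schur lam"
proof -
  let ?F = "enlargements m lam p"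
  let ?G = "split_last m"
  let ?D = "\<lambda>\<nu>. {i. i < m \<and> lookup lam i < lookup \<nu> i}"
  let ?\<nu>0 = "lam + Poly_Mapping.single m p"
  have lam0: "lookup lam i = 0" if "m \<le> i" for i
    using lam that by (metis in_keys_iff leD lessThan_iff subsetD)
  have key: "(\<Sum>\<mu>\<in>?F. ?G (raise_set (A \<times> {m}) \<mu>)) = (\<Sum>\<nu> | \<nu> \<in> ?F \<and> A \<subseteq> ?D \<nu>. ?G \<nu>)"
    if A: "A \<subseteq> {..<m}" for A
  proof -
    note sh = lookup_shift_column[OF A]
    have "m \<notin> A" "finite A" using A finite_subset by auto
    have total: "(\<Sum>i\<le>m. lookup (shift (A \<times> {m})) i) = 0"
    proof -
      have "(\<Sum>i\<le>m. lookup (shift (A \<times> {m})) i) = (\<Sum>i<m. of_bool (i \<in> A)) - int (card A)"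
        by (simp add: sh lessThan_Suc_atMost[symmetric])
      also have "(\<Sum>i<m. of_bool (i \<in> A)) = int (card A)"
        using A by (simp add: of_bool_def sum.If_cases Int_absorb1 Int_commute[of A])
      finally show ?thesis by simp
    qed
    \<comment> \<open>Vectors \<open>\<mu>\<close> whose row \<open>m\<close> has fewer than \<open>card A\<close> boxes leave the set of enlargements
      when raised, but they contribute zero.\<close>
    show ?thesis
    proof (rule sum.reindex_bij_witness_not_neutral[where
          S' = "{\<mu> \<in> ?F. lookup \<mu> m < int (card A)}" and T' = "{}" and
          j = "raise_set (A \<times> {m})" and i = "\<lambda>\<nu>. \<nu> - shift (A \<times> {m})"], goal_cases)
      case (4 \<mu>)
      then have \<mu>: "\<mu> \<in> ?F" "int (card A) \<le> lookup \<mu> m" by auto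
      have "lookup lam i \<le> lookup (raise_set (A \<times> {m}) \<mu>) i" for i
        using \<mu> lam0[of m] by (cases "i = m")
          (auto simp: enlargements_def contained_def raise_set_shift lookup_add sh add_increasing2)
      moreover have "lookup lam i < lookup (raise_set (A \<times> {m}) \<mu>) i" if "i \<in> A" for i
      proof -
        have "lookup lam i \<le> lookup \<mu> i" using \<mu>(1) by (simp add: enlargements_def contained_def)
        then show ?thesis
          using that \<open>m \<notin> A\<close> by (auto simp: raise_set_shift lookup_add sh)
      qed
      moreover have "(\<Sum>i\<le>m. lookup (raise_set (A \<times> {m}) \<mu>) i - lookup lam i) = p"
        using \<mu>(1) total by (simp add: enlargements_def raise_set_shift lookup_add sum.distrib
            sum_subtractf)
      moreover have "lookup (raise_set (A \<times> {m}) \<mu>) i = 0" if "i > m" for i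
        using \<mu>(1) A that
        by (auto simp: enlargements_def keys_subset_atMost_iff raise_set_shift lookup_add sh)
      ultimately show ?case
        using A by (auto simp: enlargements_def contained_def keys_subset_atMost_iff)
    next
      case (6 \<nu>)
      then have \<nu>: "\<nu> \<in> ?F" "A \<subseteq> ?D \<nu>" by auto
      let ?\<mu> = "\<nu> - shift (A \<times> {m})"
      have c: "lookup lam i \<le> lookup \<nu> i" for i using \<nu>(1) by (simp add: enlargements_def contained_def)
      have "lookup lam i \<le> lookup ?\<mu> i" for i
        using \<nu>(2) c[of i] by (cases "i \<in> A") (auto simp: lookup_minus sh)
      moreover have "(\<Sum>i\<le>m. lookup ?\<mu> i - lookup lam i) = p"
        using \<nu>(1) total by (simp add: enlargements_def lookup_minus sum_subtractf)
      moreover have "lookup ?\<mu> i = 0" if "i > m" for i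
        using \<nu>(1) A that by (auto simp: enlargements_def keys_subset_atMost_iff lookup_minus sh)
      moreover have "int (card A) \<le> lookup ?\<mu> m"
        using c[of m] lam0[of m] by (simp add: lookup_minus sh)
      ultimately show ?case
        by (auto simp: enlargements_def contained_def keys_subset_atMost_iff)
    next
      case (7 \<mu>)
      then show ?case
        by (intro split_last_eq_0) (simp add: raise_set_shift lookup_add sh)
    qed (auto simp: raise_set_shift finite_enlargements)
  qed
  have D_empty: "?D \<nu> = {} \<longleftrightarrow> \<nu> = ?\<nu>0" if "\<nu> \<in> ?F" for \<nu>
  proof
    assume D: "?D \<nu> = {}"
    have eq: "lookup \<nu> i = lookup lam i" if "i < m" for i
    proof (rule antisym)
      have "i \<notin> ?D \<nu>" unfolding D by simp
      then show "lookup \<nu> i \<le> lookup lam i" using that by simp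
      show "lookup lam i \<le> lookup \<nu> i" using \<open>\<nu> \<in> ?F\<close> by (simp add: enlargements_def contained_def)
    qed
    have "(\<Sum>i\<le>m. lookup \<nu> i - lookup lam i) = (\<Sum>i\<in>{m}. lookup \<nu> i - lookup lam i)"
      by (rule sum.mono_neutral_right) (auto simp: eq)
    then have "lookup \<nu> m = p"
      using \<open>\<nu> \<in> ?F\<close> lam0[of m] by (simp add: enlargements_def)
    moreover have "lookup \<nu> i = 0" if "m < i" for i
      using \<open>\<nu> \<in> ?F\<close> that by (simp add: enlargements_def keys_subset_atMost_iff)
    ultimately have "lookup \<nu> i = lookup ?\<nu>0 i" for i
      using eq[of i] lam0[of i] by (cases i m rule: linorder_cases)
        (simp_all add: lookup_add lookup_single)
    then show "\<nu> = ?\<nu>0" by (rule poly_mapping_eqI)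
  qed (auto simp: lookup_add lookup_single)
  have \<nu>0: "?\<nu>0 \<in> ?F"
    using p lam0 by (auto simp: enlargements_def contained_def keys_subset_atMost_iff lookup_add
        lookup_single when_def)
  have "(\<Sum>\<mu>\<in>?F. schur \<mu>)
      = (\<Sum>\<mu>\<in>?F. \<Sum>A\<in>Pow {..<m}. (-1) ^ card A * ?G (raise_set (A \<times> {m}) \<mu>))"
    by (rule sum.cong) (simp_all add: schur_expand_last enlargements_def)
  also have "\<dots> = (\<Sum>A\<in>Pow {..<m}. \<Sum>\<mu>\<in>?F. (-1) ^ card A * ?G (raise_set (A \<times> {m}) \<mu>))"
    by (rule sum.swap)
  also have "\<dots> = (\<Sum>A\<in>Pow {..<m}. \<Sum>\<nu> | \<nu> \<in> ?F \<and> A \<subseteq> ?D \<nu>. (-1) ^ card A * ?G \<nu>)"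
    by (rule sum.cong) (simp_all add: key flip: sum_distrib_left)
  also have "\<dots> = (\<Sum>\<nu>\<in>?F. \<Sum>A | A \<in> Pow {..<m} \<and> A \<subseteq> ?D \<nu>. (-1) ^ card A * ?G \<nu>)"
    by (rule sum.swap_restrict) (simp_all add: finite_enlargements)
  also have "\<dots> = (\<Sum>\<nu>\<in>?F. if \<nu> = ?\<nu>0 then ?G \<nu> else 0)"
  proof (rule sum.cong)
    fix \<nu>
    assume "\<nu> \<in> ?F"
    have "{A. A \<in> Pow {..<m} \<and> A \<subseteq> ?D \<nu>} = Pow (?D \<nu>)" by auto
    then show "(\<Sum>A | A \<in> Pow {..<m} \<and> A \<subseteq> ?D \<nu>. (-1) ^ card A * ?G \<nu>)
        = (if \<nu> = ?\<nu>0 then ?G \<nu> else 0)"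
      using D_empty[OF \<open>\<nu> \<in> ?F\<close>]
      by (simp add: sum_alternating_Pow flip: sum_distrib_right)
  qed simp
  also have "\<dots> = ?G ?\<nu>0"
    using \<nu>0 by (simp add: finite_enlargements)
  also have "\<dots> = u p * schur lam"
    using lam0[of m] by (simp add: split_last_def lookup_add)
  finally show ?thesis .
qed

section \<open>Cancellation outside the horizontal strips\<close>

definition interlaces :: "int_vec \<Rightarrow> int_vec \<Rightarrow> bool" where
  "interlaces lam \<mu> \<longleftrightarrow> (\<forall>i. lookup \<mu> (Suc i) \<le> lookup lam i)"

lemma sum_reflect:
  assumes "k < m"
  shows "(\<Sum>i\<le>m. lookup (reflect k \<mu>) i) = (\<Sum>i\<le>m. lookup \<mu> i)"
proof -
  have split: "(\<Sum>i\<le>m. f i) = f k + f (Suc k) + (\<Sum>i\<in>{..m} - {k, Suc k}. f i)"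
    for f :: "nat \<Rightarrow> int"
    using sum.subset_diff[of "{k, Suc k}" "{..m}" f] assms by simp
  show ?thesis
    unfolding split[of "lookup (reflect k \<mu>)"] split[of "lookup \<mu>"]
    by (auto simp: lookup_reflect intro!: sum.cong)
qed

text \<open>Reflection at a row \<open>k\<close> with \<open>lam\<^sub>k < \<mu>\<^sub>k\<^sub>+\<^sub>1\<close> keeps both \<open>lam \<subseteq> \<mu>\<close> and this
  inequality, because \<open>\<mu>\<^sub>k\<^sub>+\<^sub>1 - 1 \<ge> lam\<^sub>k\<close> and \<open>\<mu>\<^sub>k + 1 > lam\<^sub>k \<ge> lam\<^sub>k\<^sub>+\<^sub>1\<close>.  It may create or destroy
  such an inequality at \<open>k - 1\<close>, but not at any row beyond \<open>k\<close>; choosing \<open>k\<close> maximal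
  therefore makes it an involution.\<close>

lemma sum_not_interlacing:
  assumes lam: "Poly_Mapping.keys lam \<subseteq> {..<m}" and part: "is_partition lam"
  shows "(\<Sum>\<mu> | \<mu> \<in> enlargements m lam p \<and> \<not> interlaces lam \<mu>. schur \<mu>) = 0"
proof -
  let ?B = "{\<mu>. \<mu> \<in> enlargements m lam p \<and> \<not> interlaces lam \<mu>}"
  define violations where "violations \<mu> = {i. lookup lam i < lookup \<mu> (Suc i)}" for \<mu>
  define k where "k \<mu> = Max (violations \<mu>)" for \<mu>
  have lam0: "lookup lam i = 0" if "m \<le> i" for i
    using lam that by (metis in_keys_iff leD lessThan_iff subsetD)
  have desc: "lookup lam (Suc i) \<le> lookup lam i" for i
    using part by (simp add: is_partition_def)
  have violations: "violations \<mu> \<subseteq> {..<m}" "finite (violations \<mu>)" "k \<mu> \<in> violations \<mu>"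
    if "\<mu> \<in> ?B" for \<mu>
  proof -
    have "lookup \<mu> (Suc i) = 0" if "m \<le> i" for i
      using \<open>\<mu> \<in> ?B\<close> that by (simp add: enlargements_def keys_subset_atMost_iff)
    then show *: "violations \<mu> \<subseteq> {..<m}"
      using lam0 unfolding violations_def by (metis (mono_tags, lifting) lessThan_iff linorder_not_le
          mem_Collect_eq order_less_irrefl subsetI)
    then show "finite (violations \<mu>)" using finite_subset by blast
    moreover have "violations \<mu> \<noteq> {}"
      using \<open>\<mu> \<in> ?B\<close> by (auto simp: violations_def interlaces_def not_le)
    ultimately show "k \<mu> \<in> violations \<mu>" unfolding k_def by (rule Max_in)
  qed
  have refl: "reflect (k \<mu>) \<mu> \<in> ?B" "k (reflect (k \<mu>) \<mu>) = k \<mu>" if \<mu>: "\<mu> \<in> ?B" for \<mu>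
  proof -
    let ?k = "k \<mu>" and ?\<nu> = "reflect (k \<mu>) \<mu>"
    have k: "?k < m" "lookup lam ?k < lookup \<mu> (Suc ?k)"
      using violations[OF \<mu>] by (auto simp: violations_def)
    have c: "lookup lam i \<le> lookup \<mu> i" for i
      using \<mu> by (simp add: enlargements_def contained_def)
    have k': "?k \<in> violations ?\<nu>"
      using c[of ?k] by (simp add: violations_def lookup_reflect)
    have "lookup lam i \<le> lookup ?\<nu> i" for i
      using c[of i] c[of ?k] k desc[of ?k] by (simp add: lookup_reflect)
    moreover have "(\<Sum>i\<le>m. lookup ?\<nu> i - lookup lam i) = p"
      using \<mu> by (simp add: enlargements_def sum_subtractf sum_reflect[OF k(1)])
    moreover have "lookup ?\<nu> i = 0" if "i > m" for i
      using \<mu> k(1) that by (simp add: enlargements_def keys_subset_atMost_iff lookup_reflect)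
    moreover have "\<not> interlaces lam ?\<nu>"
      using k' by (auto simp: violations_def interlaces_def not_le)
    ultimately show B: "?\<nu> \<in> ?B"
      by (simp add: enlargements_def contained_def keys_subset_atMost_iff)
    show "k ?\<nu> = ?k"
      unfolding k_def[of ?\<nu>]
    proof (rule Max_eqI)
      fix i
      assume i: "i \<in> violations ?\<nu>"
      show "i \<le> ?k"
      proof (rule ccontr)
        assume "\<not> i \<le> ?k"
        then have "i \<in> violations \<mu>" using i by (simp add: violations_def lookup_reflect)
        then have "i \<le> ?k" unfolding k_def using violations(2)[OF \<mu>] by (rule Max_ge[rotated])
        with \<open>\<not> i \<le> ?k\<close> show False by simp
      qed
    qed (use k' violations(2)[OF B] in auto)
  qed
  have "(\<Sum>\<mu>\<in>?B. schur \<mu>) = (\<Sum>\<mu>\<in>?B. - schur \<mu>)"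
    by (rule sum.reindex_bij_witness[where i = "\<lambda>\<mu>. reflect (k \<mu>) \<mu>" and
          j = "\<lambda>\<mu>. reflect (k \<mu>) \<mu>"])
      (use refl in \<open>simp_all add: reflect_reflect schur_reflect\<close>)
  then have "(\<Sum>\<mu>\<in>?B. schur \<mu>) = - (\<Sum>\<mu>\<in>?B. schur \<mu>)"
    by (simp add: sum_negf)
  \<comment> \<open>The fixed points of the involution are covered too, as the coefficients have no
    2-torsion.\<close>
  then have double: "Poly_Mapping.lookup (\<Sum>\<mu>\<in>?B. schur \<mu>) x
      = - Poly_Mapping.lookup (\<Sum>\<mu>\<in>?B. schur \<mu>) x" for x
    by (subst (asm) poly_mapping_eq_iff) (simp only: fun_eq_iff lookup_uminus)
  have "Poly_Mapping.lookup (\<Sum>\<mu>\<in>?B. schur \<mu>) x = 0" for x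
    using double[of x] by linarith
  then show ?thesis by (intro poly_mapping_eqI) simp
qed

text \<open>For partitions, a column containing two new boxes also contains two vertically adjacent
  ones, so being a horizontal strip is a condition on consecutive rows.  Conversely,
  \<open>\<mu>\<^sub>i\<^sub>+\<^sub>1 \<le> lam\<^sub>i \<le> \<mu>\<^sub>i\<close> forces \<open>\<mu>\<close> to be a partition.  In particular \<open>\<mu>\<close> has at most one
  row more than \<open>lam\<close>, so the single extra row \<open>m\<close> suffices.\<close>

lemma pieri_step_iff:
  assumes lam: "Poly_Mapping.keys lam \<subseteq> {..<m}" and part: "is_partition lam"
  shows "is_partition \<mu> \<and> pieri_step lam p \<mu> \<longleftrightarrow> \<mu> \<in> enlargements m lam p \<and> interlaces lam \<mu>"
proof -
  have lam0: "lookup lam i = 0" if "m \<le> i" for i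
    using lam that by (metis in_keys_iff leD lessThan_iff subsetD)
  have nonneg: "0 \<le> lookup \<nu> i" if "is_partition \<nu>" for \<nu> i
    using that unfolding is_partition_def by (meson order_trans)
  have anti: "lookup \<nu> j \<le> lookup \<nu> i" if "is_partition \<nu>" "i \<le> j" for \<nu> i j
    using that(2) by (rule lift_Suc_antimono_le[rotated])
      (use that(1) in \<open>simp add: is_partition_def\<close>)
  have strip: "horizontal_strip (diagram \<mu> - diagram lam) \<longleftrightarrow> interlaces lam \<mu>"
    if \<mu>: "is_partition \<mu>" and c: "contained lam \<mu>"
  proof
    assume h: "horizontal_strip (diagram \<mu> - diagram lam)"
    show "interlaces lam \<mu>"
      unfolding interlaces_def
    proof (intro allI, rule ccontr)
      fix i
      assume "\<not> lookup \<mu> (Suc i) \<le> lookup lam i"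
      then have "lookup lam i < lookup \<mu> (Suc i)" by simp
      moreover have "lookup \<mu> (Suc i) \<le> lookup \<mu> i" "lookup lam (Suc i) \<le> lookup lam i"
        using anti[OF \<mu>] anti[OF part] by simp_all
      ultimately have
        "(i, nat (lookup lam i)) \<in> diagram \<mu> - diagram lam"
        "(Suc i, nat (lookup lam i)) \<in> diagram \<mu> - diagram lam"
        using nonneg[OF part, of i] by (auto simp: diagram_def)
      then show False using h unfolding horizontal_strip_def by (metis n_not_Suc_n)
    qed
  next
    assume il: "interlaces lam \<mu>"
    have False if "i < i'" "(i, j) \<in> diagram \<mu> - diagram lam"
      "(i', j) \<in> diagram \<mu> - diagram lam" for i i' j
    proof -
      have "lookup \<mu> i' \<le> lookup \<mu> (Suc i)" using anti[OF \<mu>] that(1) by simp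
      also have "\<dots> \<le> lookup lam i" using il by (simp add: interlaces_def)
      finally show False using that by (auto simp: diagram_def)
    qed
    then show "horizontal_strip (diagram \<mu> - diagram lam)"
      unfolding horizontal_strip_def by (metis nat_neq_iff)
  qed
  have card: "int (card (diagram \<mu> - diagram lam)) = (\<Sum>i\<le>m. lookup \<mu> i - lookup lam i)"
    if "contained lam \<mu>" "Poly_Mapping.keys \<mu> \<subseteq> {..m}"
  proof -
    have c: "lookup lam i \<le> lookup \<mu> i" for i using that by (simp add: contained_def)
    have "diagram \<mu> - diagram lam = (SIGMA i:{..m}. {nat (lookup lam i)..<nat (lookup \<mu> i)})"
    proof -
      have "i \<le> m" if "int j < lookup \<mu> i" for i j
        using \<open>Poly_Mapping.keys \<mu> \<subseteq> {..m}\<close> that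
        by (metis keys_subset_atMost_iff leI of_nat_less_0_iff)
      then show ?thesis by (auto simp: diagram_def)
    qed
    also have "int (card \<dots>) = (\<Sum>i\<le>m. int (nat (lookup \<mu> i) - nat (lookup lam i)))"
      by (simp add: card_SigmaI)
    also have "\<dots> = (\<Sum>i\<le>m. lookup \<mu> i - lookup lam i)"
    proof (rule sum.cong)
      fix i
      show "int (nat (lookup \<mu> i) - nat (lookup lam i)) = lookup \<mu> i - lookup lam i"
        using c[of i] nonneg[OF part, of i] by simp
    qed simp
    finally show ?thesis .
  qed
  show ?thesis
  proof
    assume "is_partition \<mu> \<and> pieri_step lam p \<mu>"
    then have \<mu>: "is_partition \<mu>" "contained lam \<mu>" "pieri_step lam p \<mu>"
      by (auto simp: pieri_step_def)
    then have il: "interlaces lam \<mu>" using strip by (simp add: pieri_step_def)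
    have "lookup \<mu> i = 0" if "i > m" for i
    proof -
      have "i = Suc (i - 1)" "m \<le> i - 1" using that by simp_all
      then have "lookup \<mu> i \<le> 0"
        using il lam0[of "i - 1"] unfolding interlaces_def by metis
      then show ?thesis using nonneg[OF \<mu>(1), of i] by simp
    qed
    then have "Poly_Mapping.keys \<mu> \<subseteq> {..m}" by (simp add: keys_subset_atMost_iff)
    then show "\<mu> \<in> enlargements m lam p \<and> interlaces lam \<mu>"
      using \<mu> il card by (simp add: enlargements_def pieri_step_def)
  next
    assume r: "\<mu> \<in> enlargements m lam p \<and> interlaces lam \<mu>"
    then have c: "contained lam \<mu>" and keys: "Poly_Mapping.keys \<mu> \<subseteq> {..m}"
      and il: "interlaces lam \<mu>"
      by (auto simp: enlargements_def)
    have "is_partition \<mu>"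
      unfolding is_partition_def
    proof (intro allI conjI)
      fix i
      show "lookup \<mu> (Suc i) \<le> lookup \<mu> i"
        using il c by (meson interlaces_def contained_def order_trans)
      show "0 \<le> lookup \<mu> (Suc i)"
        using c nonneg[OF part] by (meson contained_def order_trans)
    qed
    then show "is_partition \<mu> \<and> pieri_step lam p \<mu>"
      using r strip c card[OF c keys] by (simp add: pieri_step_def enlargements_def)
  qed
qed

theorem mainTheorem1:
  fixes p :: int and lam :: "nat \<Rightarrow>\<^sub>0 int"
  assumes "p > 0" and "is_partition lam"
  shows "u p * schur lam = (\<Sum>\<mu> | is_partition \<mu> \<and> pieri_step lam p \<mu>. schur \<mu>)"
proof -
  obtain m where m: "Poly_Mapping.keys lam \<subseteq> {..<m}"
    using finite_nat_set_iff_bounded[of "Poly_Mapping.keys lam"] by auto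
  let ?F = "enlargements m lam p"
  have "u p * schur lam = (\<Sum>\<mu>\<in>?F. schur \<mu>)"
    using sum_enlargements[OF m] assms(1) by simp
  also have "\<dots> = (\<Sum>\<mu> | \<mu> \<in> ?F \<and> interlaces lam \<mu>. schur \<mu>)
      + (\<Sum>\<mu> | \<mu> \<in> ?F \<and> \<not> interlaces lam \<mu>. schur \<mu>)"
    by (subst sum.union_disjoint[symmetric])
      (auto simp: finite_enlargements intro: sum.cong)
  also have "\<dots> = (\<Sum>\<mu> | \<mu> \<in> ?F \<and> interlaces lam \<mu>. schur \<mu>)"
    by (simp add: sum_not_interlacing[OF m assms(2)])
  finally show ?thesis by (simp add: pieri_step_iff[OF m assms(2)])
qed

end
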